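(* Let $D\in\mathbb{R}^{n\times k}$, let $m\ge1$ be an integer, and let $f(P)=\mathrm{tr}((P^{\mathrm T}D)^m)$ with associated symmetric matrix-valued function $$H(P)=m\Big[D(P^{\mathrm T}D)^{m-1}P^{\mathrm T}+P(D^{\mathrm T}P)^{m-1}D^{\mathrm T}\Big],$$ so that $H(P)P-\frac{\partial f(P)}{\partial P}=P\big[m(D^{\mathrm T}P)^m\big]$ for $P\in\mathrm{St}(k,n)$. Let $\mathbb{P}=\mathrm{St}(k,n)_{D+}$. Then $$\mathrm{tr}(P^{\mathrm T}H(P)P)=2m\,\mathrm{tr}((P^{\mathrm T}D)^m)\quad\text{for }P\in\mathrm{St}(k,n),$$ $$\mathrm{tr}(\widetilde P^{\mathrm T}H(P)\widetilde P)\le2\,\mathrm{tr}((\widetilde P^{\mathrm T}D)^m)+2(m-1)\,\mathrm{tr}((P^{\mathrm T}D)^m)\quad\text{for }P,\widetilde P\in\mathbb{P}.$$ These imply that conditions (1) and (2) of the definition of an atomic function for NEPv hold with $\underline{\alpha}=2$ and $\underline{\beta}=2(m-1)$, and thus $f(P)=\mathrm{tr}((P^{\mathrm T}D)^m)$ is an atomic function for NEPv. Furthermore, any $P\in\mathrm{St}(k,n)$ that solves $H(P)P=P\Omega$ for some $\Omega\in\mathbb{R}^{k\times k}$ and is such that $(P^{\mathrm T}D)^m$ is symmetric is a solution to the KKT condition $\frac{\partial f(P)}{\partial P}=P\Lambda$, $\Lambda^{\mathrm T}=\Lambda\in\mathbb{R}^{k\times k}$, $P\in\mathrm{St}(k,n)$,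 and vice versa.
   Context: $1\le k\le n$; $\mathrm{St}(k,n)=\{P\in\mathbb{R}^{n\times k}: P^{\mathrm T}P=I_k\}$; $\mathrm{St}(k,n)_{D+}=\{X\in\mathrm{St}(k,n): X^{\mathrm T}D\succeq0\}$; $A\succeq0$ means symmetric positive semidefinite; $\partial f(P)/\partial P$ is the $n\times k$ matrix of partial derivatives with all entries of $P$ treated as independent. Atomic function for NEPv: a function $f$ on a neighborhood $\{P\in\mathbb{R}^{n\times k}:\|P^{\mathrm T}P-I_k\|<\delta\}$ of $\mathrm{St}(k,n)$ for which there are a symmetric matrix-valued function $H(P)\in\mathbb{R}^{n\times n}$ for $P\in\mathrm{St}(k,n)$, a subset $\mathbb{P}\subseteq\mathrm{St}(k,n)$ and constants $\underline{\alpha}>0$, $\underline{\beta}\ge 0$, $\underline{\gamma}=\underline{\alpha}+\underline{\beta}$ such that (1) $\mathrm{tr}(P^{\mathrm T}H(P)P)=\underline{\gamma} f(P)$ for all $P\in\mathbb{P}$; and (2) given $P\in\mathbb{P}$ and $\widehat P\in\mathrm{St}(k,n)$, there exists $Q\in\mathrm{St}(k,k)$ such that $\widetilde P=\widehat PQ\in\mathbb{P}$ and $\mathrm{tr}(\widehat P^{\mathrm T}H(P)\widehat P)\le\underline{\alpha} f(\widetilde P)+\underline{\beta} f(P)$. *)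

theory Defs
  imports "HOL-Analysis.Analysis"
begin

text \<open>
  An \<open>n \<times> k\<close> real matrix has type \<^typ>\<open>real^'k^'n\<close>; the finite index types
  \<open>'n\<close> and \<open>'k\<close> play the role of the dimensions.
\<close>

text \<open>
  The operator \<open>^\<close> on \<^typ>\<open>real^'k^'k\<close> is the entrywise power, since \<open>*\<close> on vectors is
  componentwise; hence a separate power with respect to \<open>**\<close>.
\<close>

primrec matpow :: "real^'k^'k \<Rightarrow> nat \<Rightarrow> real^'k^'k" where
  "matpow A 0 = mat 1"
| "matpow A (Suc m) = A ** matpow A m"

definition symmetric_mat :: "real^'k^'k \<Rightarrow> bool" where
  "symmetric_mat A \<longleftrightarrow> transpose A = A"

definition psd :: "real^'k^'k \<Rightarrow> bool" where
  "psd A \<longleftrightarrow> symmetric_mat A \<and> (\<forall>x. 0 \<le> x \<bullet> (A *v x))"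

definition St :: "(real^'k^'n) set" where
  "St = {P. transpose P ** P = mat 1}"

definition St_Dplus :: "real^'k^'n \<Rightarrow> (real^'k^'n) set" where
  "St_Dplus D = {X \<in> St. psd (transpose X ** D)}"

text \<open>The norm is the Euclidean norm of all entries (Frobenius norm).\<close>

definition St_nbhd :: "real \<Rightarrow> (real^'k^'n) set" where
  "St_nbhd \<delta> = {P. norm (transpose P ** P - mat 1) < \<delta>}"

text \<open>
  The \<open>(i, j)\<close> entry is the derivative with respect to the entry \<open>P $ i $ j\<close> alone, all
  other entries being held fixed.
\<close>

definition partials :: "(real^'k^'n \<Rightarrow> real) \<Rightarrow> real^'k^'n \<Rightarrow> real^'k^'n" where
  "partials f P =
     (\<chi> i j. deriv (\<lambda>t. f (\<chi> a b. if a = i \<and> b = j then t else P $ a $ b)) (P $ i $ j))"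

definition atomic_cond1 ::
  "(real^'k^'n \<Rightarrow> real) \<Rightarrow> (real^'k^'n \<Rightarrow> real^'n^'n) \<Rightarrow> (real^'k^'n) set \<Rightarrow> real \<Rightarrow> bool" where
  "atomic_cond1 f H PP \<gamma> \<longleftrightarrow>
     (\<forall>P\<in>PP. trace (transpose P ** H P ** P) = \<gamma> * f P)"

definition atomic_cond2 ::
  "(real^'k^'n \<Rightarrow> real) \<Rightarrow> (real^'k^'n \<Rightarrow> real^'n^'n) \<Rightarrow> (real^'k^'n) set \<Rightarrow> real \<Rightarrow> real \<Rightarrow> bool" where
  "atomic_cond2 f H PP \<alpha> \<beta> \<longleftrightarrow>
     (\<forall>P\<in>PP. \<forall>Ph\<in>St. \<exists>Q\<in>(St :: (real^'k^'k) set).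
        Ph ** Q \<in> PP \<and>
        trace (transpose Ph ** H P ** Ph) \<le> \<alpha> * f (Ph ** Q) + \<beta> * f P)"

definition atomic_NEPv_with ::
  "(real^'k^'n \<Rightarrow> real) \<Rightarrow> (real^'k^'n \<Rightarrow> real^'n^'n) \<Rightarrow> (real^'k^'n) set \<Rightarrow> real \<Rightarrow> real \<Rightarrow> bool" where
  "atomic_NEPv_with f H PP \<alpha> \<beta> \<longleftrightarrow>
     (\<forall>P\<in>St. symmetric_mat (H P)) \<and> PP \<subseteq> St \<and> \<alpha> > 0 \<and> \<beta> \<ge> 0 \<and>
     atomic_cond1 f H PP (\<alpha> + \<beta>) \<and> atomic_cond2 f H PP \<alpha> \<beta>"

text \<open>
  \<open>U\<close> is the domain of \<open>f\<close>. HOL functions are total, but only values of \<open>f\<close> on \<^const>\<open>St\<close>,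
  which every \<^term>\<open>St_nbhd \<delta>\<close> with \<open>\<delta> > 0\<close> contains, enter the conditions.
\<close>

definition atomic_NEPv :: "(real^'k^'n) set \<Rightarrow> (real^'k^'n \<Rightarrow> real) \<Rightarrow> bool" where
  "atomic_NEPv U f \<longleftrightarrow>
     (\<exists>\<delta>>0. U = St_nbhd \<delta>) \<and> (\<exists>H PP \<alpha> \<beta>. atomic_NEPv_with f H PP \<alpha> \<beta>)"

definition f_pow :: "real^'k^'n \<Rightarrow> nat \<Rightarrow> real^'k^'n \<Rightarrow> real" where
  "f_pow D m P = trace (matpow (transpose P ** D) m)"

definition H_pow :: "real^'k^'n \<Rightarrow> nat \<Rightarrow> real^'k^'n \<Rightarrow> real^'n^'n" where
  "H_pow D m P = real m *\<^sub>R
     (D ** matpow (transpose P ** D) (m - 1) ** transpose P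
      + P ** matpow (transpose D ** P) (m - 1) ** transpose D)"

definition KKT :: "(real^'k^'n \<Rightarrow> real) \<Rightarrow> real^'k^'n \<Rightarrow> bool" where
  "KKT f P \<longleftrightarrow> P \<in> St \<and> (\<exists>\<Lambda>::real^'k^'k. symmetric_mat \<Lambda> \<and> partials f P = P ** \<Lambda>)"

end

theory Submission
  imports Defs
begin

text \<open>
  Since \<open>\<partial>f(P)/\<partial>P = m D (P\<^sup>T D)\<^sup>m\<^sup>-\<^sup>1\<close>, all but the trace inequality and
  condition (2) is matrix algebra. A multiplier \<open>\<Lambda>\<close>
  is forced to equal \<open>m (P\<^sup>T D)\<^sup>m\<close>, hence the symmetry requirement in the KKT characterisation. The trace
  inequality bounds \<open>m tr(B A\<^sup>m\<^sup>-\<^sup>1 W)\<close> for positive semidefinite \<open>A = P\<^sup>T D\<close>, \<open>B = R\<^sup>T D\<close> and the contraction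
  \<open>W = P\<^sup>T R\<close>: after diagonalising \<open>A\<close> and \<open>B\<close> it follows from Young's inequality
  \<open>m b a\<^sup>m\<^sup>-\<^sup>1 \<le> b\<^sup>m + (m - 1) a\<^sup>m\<close> for the eigenvalues and a doubly substochastic weight matrix.
  For condition (2), \<open>Q\<close> comes from a polar decomposition. Diagonalisation and polar decomposition
  are both obtained by maximising a continuous function over the compact orthogonal group.
\<close>

section \<open>Matrix powers and their derivatives\<close>

lemma bounded_bilinear_matrix_mult:
  "bounded_bilinear ((**) :: real^'b^'a \<Rightarrow> real^'c^'b \<Rightarrow> real^'c^'a)"
  unfolding bilinear_conv_bounded_bilinear[symmetric] bilinear_def
  by (auto intro!: linearI simp: matrix_matrix_mult_def vec_eq_iff sum.distrib
      sum_distrib_left algebra_simps)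

lemma matrix_mult_scaleR:
  fixes A :: "real^'b^'a" and B :: "real^'c^'b"
  shows "(c *\<^sub>R A) ** B = c *\<^sub>R (A ** B)" "A ** (c *\<^sub>R B) = c *\<^sub>R (A ** B)"
  by (simp_all add: bounded_bilinear.scaleR_left bounded_bilinear.scaleR_right
      bounded_bilinear_matrix_mult)

lemma matrix_add_rdistrib: "(A + B) ** C = A ** C + B ** (C :: real^'c^'b)"
  by (rule bounded_bilinear.add_left[OF bounded_bilinear_matrix_mult])

lemma trace_scaleR: "trace (c *\<^sub>R (A :: real^'a^'a)) = c * trace A"
  by (simp add: trace_def sum_distrib_left)

lemma trace_transpose: "trace (transpose A) = trace A"
  by (simp add: trace_def transpose_def)

lemma transpose_add: "transpose (A + B) = transpose A + transpose B"
  by (simp add: transpose_def vec_eq_iff)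

lemma matpow_commute:
  assumes "C ** A = A ** C"
  shows "C ** matpow A m = matpow A m ** C"
proof (induction m)
  case (Suc m)
  have "C ** matpow A (Suc m) = A ** (C ** matpow A m)"
    using assms by (simp add: matrix_mul_assoc)
  then show ?case
    using Suc by (simp add: matrix_mul_assoc)
qed simp

lemma matpow_Suc_right: "matpow A (Suc m) = matpow A m ** A"
  by (simp add: matpow_commute)

lemma transpose_matpow: "transpose (matpow A m) = matpow (transpose A) m"
  by (induction m) (simp_all add: matrix_transpose_mul flip: matpow_Suc_right)

lemma matpow_conj:
  fixes A U :: "real^'k^'k"
  assumes "U ** transpose U = mat 1"
  shows "matpow (transpose U ** A ** U) m = transpose U ** matpow A m ** U"
proof (induction m)
  case 0
  have "transpose U ** U = mat 1" using assms by (rule matrix_left_right_inverse[THEN iffD1])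
  then show ?case by simp
next
  case (Suc m)
  have "matpow (transpose U ** A ** U) (Suc m)
      = transpose U ** A ** (U ** transpose U) ** matpow A m ** U"
    unfolding matpow.simps Suc by (simp add: matrix_mul_assoc)
  then show ?case
    by (simp add: assms matrix_mul_assoc)
qed

text \<open>
  \<open>F\<close> itself has no closed form here, since \<open>X t\<close> and \<open>E\<close> need not commute. The factor \<open>C\<close>
  makes the induction go through: it absorbs one \<open>X t\<close> per step.
\<close>

lemma has_vector_derivative_matpow:
  assumes X: "(X has_vector_derivative E) (at t)"
  shows "\<exists>F. ((\<lambda>t. matpow (X t) m) has_vector_derivative F) (at t) \<and>
    (\<forall>C. C ** X t = X t ** C \<longrightarrow> trace (C ** F) = m * trace (C ** matpow (X t) (m - 1) ** E))"
proof (induction m)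
  case 0
  show ?case
    by (rule exI[of _ 0]) (simp add: trace_def matrix_matrix_mult_def)
next
  case (Suc m)
  then obtain F where F: "((\<lambda>t. matpow (X t) m) has_vector_derivative F) (at t)"
    and tr: "\<And>C. C ** X t = X t ** C \<Longrightarrow> trace (C ** F) = m * trace (C ** matpow (X t) (m - 1) ** E)"
    by blast
  have "((\<lambda>t. matpow (X t) (Suc m)) has_vector_derivative (X t ** F + E ** matpow (X t) m)) (at t)"
    using bounded_bilinear.has_vector_derivative[OF bounded_bilinear_matrix_mult X F] by simp
  moreover have "trace (C ** (X t ** F + E ** matpow (X t) m))
      = Suc m * trace (C ** matpow (X t) m ** E)" if C: "C ** X t = X t ** C" for C
  proof -
    \<comment> \<open>The product \<open>C ** X t\<close> again commutes with \<open>X t\<close>, so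
      it may replace \<open>C\<close> in the induction hypothesis.\<close>
    have "(C ** X t) ** X t = X t ** (C ** X t)"
      by (metis C matrix_mul_assoc)
    then have "trace (C ** X t ** F) = m * trace (C ** X t ** matpow (X t) (m - 1) ** E)"
      by (rule tr)
    also have "\<dots> = m * trace (C ** matpow (X t) m ** E)"
      \<comment> \<open>For \<open>m = 0\<close> the exponent \<open>m - 1\<close> truncates to 0,
        but the factor \<open>m\<close> kills both sides.\<close>
      by (cases m) (simp_all add: matrix_mul_assoc)
    finally have "trace (C ** X t ** F) = m * trace (C ** matpow (X t) m ** E)" .
    moreover have "trace (C ** E ** matpow (X t) m) = trace (C ** matpow (X t) m ** E)"
      by (metis C matpow_commute matrix_mul_assoc trace_mul_sym)
    ultimately show ?thesis
      by (simp add: matrix_add_ldistrib trace_add matrix_mul_assoc algebra_simps)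
  qed
  ultimately show ?case by auto
qed

lemma trace_matpow_has_field_derivative:
  assumes X: "(X has_vector_derivative E) (at t)"
  shows "((\<lambda>t. trace (matpow (X t) m)) has_field_derivative
    m * trace (matpow (X t) (m - 1) ** E)) (at t)"
proof -
  obtain F where F: "((\<lambda>t. matpow (X t) m) has_vector_derivative F) (at t)"
    and tr: "\<And>C. C ** X t = X t ** C \<Longrightarrow> trace (C ** F) = m * trace (C ** matpow (X t) (m - 1) ** E)"
    using has_vector_derivative_matpow[OF X] by blast
  have "linear (trace :: real^'a^'a \<Rightarrow> real)"
    by (intro linearI) (simp_all add: trace_add trace_scaleR)
  then have "bounded_linear (trace :: real^'a^'a \<Rightarrow> real)"
    by (rule linear_conv_bounded_linear[THEN iffD1])
  from bounded_linear.has_vector_derivative[OF this F] tr[of "mat 1"] show ?thesis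
    by (simp add: has_real_derivative_iff_has_vector_derivative)
qed

section \<open>Optimisation over the orthogonal group\<close>

lemma orthogonal_matrix_inner_rows:
  fixes U :: "real^'k^'k"
  shows "orthogonal_matrix U \<longleftrightarrow> (\<forall>i j. U $ i \<bullet> U $ j = (if i = j then 1 else 0))"
proof -
  have "orthogonal_matrix U \<longleftrightarrow> U ** transpose U = mat 1"
    by (simp add: orthogonal_matrix matrix_left_right_inverse)
  then show ?thesis
    by (simp add: vec_eq_iff matrix_matrix_mult_def transpose_def mat_def inner_vec_def)
qed

lemma compact_orthogonal_matrix: "compact {U :: real^'k^'k. orthogonal_matrix U}"
proof -
  have "norm U \<le> CARD('k)" if "orthogonal_matrix U" for U :: "real^'k^'k"
  proof -
    have "norm U \<le> (\<Sum>i\<in>UNIV. norm (U $ i))"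
      unfolding norm_vec_def by (rule L2_set_le_sum) simp
    then show ?thesis
      using that by (simp add: orthogonal_matrix_inner_rows norm_eq_sqrt_inner)
  qed
  then have "bounded {U :: real^'k^'k. orthogonal_matrix U}"
    unfolding bounded_iff by auto
  moreover have "closed {U :: real^'k^'k. orthogonal_matrix U}"
    unfolding orthogonal_matrix_inner_rows
    by (intro closed_Collect_all closed_Collect_eq continuous_intros)
  ultimately show ?thesis by (simp add: compact_eq_bounded_closed)
qed

lemma orthogonal_matrix_attains_sup:
  fixes g :: "real^'k^'k \<Rightarrow> real"
  assumes "continuous_on UNIV g"
  obtains U where "orthogonal_matrix U" "\<And>V. orthogonal_matrix V \<Longrightarrow> g V \<le> g U"
proof -
  have "{U :: real^'k^'k. orthogonal_matrix U} \<noteq> {}"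
    using orthogonal_matrix_id by blast
  then show ?thesis
    using continuous_attains_sup[OF compact_orthogonal_matrix, of g] assms that
    by (auto intro: continuous_on_subset)
qed

text \<open>A Givens rotation, with \<open>c\<close> and \<open>s\<close> as cosine and sine. Acting
  on rows, it alters only two summands of an objective that is a sum over rows.\<close>

definition rotate_rows :: "'k \<Rightarrow> 'k \<Rightarrow> real \<Rightarrow> real \<Rightarrow> real^'k^'k \<Rightarrow> real^'k^'k" where
  "rotate_rows i j c s U = (\<chi> l. if l = i then c *\<^sub>R U $ i + s *\<^sub>R U $ j
     else if l = j then c *\<^sub>R U $ j - s *\<^sub>R U $ i else U $ l)"

lemma orthogonal_matrix_rotate_rows:
  assumes "orthogonal_matrix U" "i \<noteq> j" "c\<^sup>2 + s\<^sup>2 = 1"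
  shows "orthogonal_matrix (rotate_rows i j c s U)"
  using assms unfolding orthogonal_matrix_inner_rows rotate_rows_def
  by (auto simp: inner_simps power2_eq_square algebra_simps)

lemma sum_rotate_rows:
  fixes h :: "'k::finite \<Rightarrow> real^'k \<Rightarrow> real"
  assumes "i \<noteq> j"
  shows "(\<Sum>l\<in>UNIV. h l (rotate_rows i j c s U $ l)) - (\<Sum>l\<in>UNIV. h l (U $ l))
    = h i (c *\<^sub>R U $ i + s *\<^sub>R U $ j) - h i (U $ i)
      + (h j (c *\<^sub>R U $ j - s *\<^sub>R U $ i) - h j (U $ j))"
proof -
  have "(\<Sum>l\<in>UNIV. h l (rotate_rows i j c s U $ l)) - (\<Sum>l\<in>UNIV. h l (U $ l))
    = (\<Sum>l\<in>{i, j}. h l (rotate_rows i j c s U $ l) - h l (U $ l))"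
    unfolding sum_subtractf[symmetric]
    by (rule sum.mono_neutral_right) (auto simp: rotate_rows_def)
  then show ?thesis using assms by (simp add: rotate_rows_def)
qed

lemma linear_le_quadratic_imp_zero:
  fixes a b :: real
  assumes "\<And>t. t * a \<le> t\<^sup>2 * b"
  shows "a = 0"
proof (rule ccontr)
  assume "a \<noteq> 0"
  \<comment> \<open>Chosen so that \<open>t\<^sup>2 * (\<bar>b\<bar> + 1)\<close> equals
    \<open>t * a\<close>, more than the hypothesis allows.\<close>
  define t where "t = a / (\<bar>b\<bar> + 1)"
  have "t * a \<le> t\<^sup>2 * b" by (rule assms)
  also have "\<dots> \<le> t\<^sup>2 * \<bar>b\<bar>" by (simp add: mult_left_mono)
  also have "\<dots> < t\<^sup>2 * (\<bar>b\<bar> + 1)" using \<open>a \<noteq> 0\<close> by (intro mult_strict_left_mono) (simp_all add: t_def)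
  also have "\<dots> = t * a" by (simp add: t_def power2_eq_square)
  finally show False by simp
qed

text \<open>
  The hypothesis is maximality at the identity: \<open>c * s * a - s\<^sup>2 * b\<close> is, up to a positive factor,
  the increment of the objective under a rotation.
\<close>

lemma first_order_optimality_rotation:
  fixes a b :: real
  assumes "\<And>c s. c\<^sup>2 + s\<^sup>2 = 1 \<Longrightarrow> c * s * a \<le> s\<^sup>2 * b"
  shows "a = 0"
proof (rule linear_le_quadratic_imp_zero)
  fix t :: real
  \<comment> \<open>The rotation with tangent \<open>t\<close>: its sine is \<open>c * t\<close>,
    and \<open>c\<^sup>2\<close> cancels from the hypothesis.\<close>
  define c where "c = 1 / sqrt (1 + t\<^sup>2)"
  have pos: "0 < 1 + t\<^sup>2" by (simp add: add_pos_nonneg)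
  then have c2: "c\<^sup>2 = 1 / (1 + t\<^sup>2)" by (simp add: c_def power_divide)
  then have "c\<^sup>2 + (c * t)\<^sup>2 = 1"
    using pos by (simp add: power_mult_distrib field_simps)
  then have "c * (c * t) * a \<le> (c * t)\<^sup>2 * b" by (rule assms)
  then have "c\<^sup>2 * (t * a) \<le> c\<^sup>2 * (t\<^sup>2 * b)"
    by (simp add: power2_eq_square algebra_simps)
  moreover have "0 < c\<^sup>2" using c2 pos by simp
  ultimately show "t * a \<le> t\<^sup>2 * b" by simp
qed

section \<open>Diagonalisation and polar decomposition\<close>

abbreviation diag_mat :: "('k \<Rightarrow> real) \<Rightarrow> real^'k^'k" where
  "diag_mat a \<equiv> \<chi> i j. if i = j then a i else 0"

lemma diag_mat_mult: "diag_mat a ** X = (\<chi> i j. a i * X $ i $ j)"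
  by (simp add: vec_eq_iff matrix_matrix_mult_def mult_delta_left)

lemma matpow_diag_mat: "matpow (diag_mat a) m = diag_mat (\<lambda>i. a i ^ m)"
proof (induction m)
  case 0
  show ?case by (simp add: mat_def vec_eq_iff)
next
  case (Suc m)
  then show ?case by (simp add: diag_mat_mult vec_eq_iff)
qed

text \<open>
  A maximiser over the orthogonal group of \<open>\<Sum>l. w l * (U $ l \<bullet> A *v U $ l)\<close>, where the weights
  \<open>w l\<close> are pairwise distinct, diagonalises \<open>A\<close>.
\<close>

lemma symmetric_mat_diagonalisable:
  fixes A :: "real^'k^'k"
  assumes A: "symmetric_mat A"
  obtains U a where "orthogonal_matrix U"
    "A = transpose U ** diag_mat a ** U"
proof -
  obtain w0 :: "'k \<Rightarrow> nat" where w0: "inj w0"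
    using finite_imp_inj_to_nat_seg[of "UNIV :: 'k set"] by auto
  define w where "w l = real (w0 l)" for l
  define h where "h l x = w l * (x \<bullet> (A *v x))" for l and x :: "real^'k"
  have "continuous_on UNIV (\<lambda>U :: real^'k^'k. \<Sum>l\<in>UNIV. h l (U $ l))"
    unfolding h_def by (intro continuous_intros bounded_linear.continuous_on[OF matrix_vector_mul_bounded_linear])
  then obtain U where U: "orthogonal_matrix U"
    and max: "\<And>V. orthogonal_matrix V \<Longrightarrow> (\<Sum>l\<in>UNIV. h l (V $ l)) \<le> (\<Sum>l\<in>UNIV. h l (U $ l))"
    by (rule orthogonal_matrix_attains_sup) blast
  have sym: "x \<bullet> (A *v y) = y \<bullet> (A *v x)" for x y
    using A by (metis dot_lmul_matrix inner_commute symmetric_mat_def transpose_matrix_vector)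
  have off: "U $ i \<bullet> (A *v U $ j) = 0" if "i \<noteq> j" for i j
  proof -
    let ?q = "\<lambda>x y. U $ x \<bullet> (A *v U $ y)"
    \<comment> \<open>This is the coefficient of \<open>c * s\<close> in the increment; distinct
      weights then force \<open>?q i j = 0\<close>.\<close>
    have "2 * (w i - w j) * ?q i j = 0"
    proof (rule first_order_optimality_rotation)
      fix c s :: real
      assume cs: "c\<^sup>2 + s\<^sup>2 = 1"
      have "h i (c *\<^sub>R U $ i + s *\<^sub>R U $ j) - h i (U $ i)
          + (h j (c *\<^sub>R U $ j - s *\<^sub>R U $ i) - h j (U $ j)) \<le> 0"
        using max[OF orthogonal_matrix_rotate_rows[OF U that cs]] sum_rotate_rows[OF that, of h c s U]
        by simp
      moreover have "h i (c *\<^sub>R U $ i + s *\<^sub>R U $ j) = w i * (c\<^sup>2 * ?q i i + 2 * c * s * ?q i j + s\<^sup>2 * ?q j j)"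
        by (simp add: h_def matrix_vector_right_distrib matrix_vector_mult_scaleR inner_simps
            sym[of "U $ j" "U $ i"] power2_eq_square algebra_simps)
      moreover have "h j (c *\<^sub>R U $ j - s *\<^sub>R U $ i) = w j * (c\<^sup>2 * ?q j j - 2 * c * s * ?q i j + s\<^sup>2 * ?q i i)"
        by (simp add: h_def matrix_vector_mult_diff_distrib matrix_vector_mult_scaleR inner_simps
            sym[of "U $ j" "U $ i"] power2_eq_square algebra_simps)
      \<comment> \<open>Inserting \<open>c\<^sup>2 + s\<^sup>2 = 1\<close> makes all terms
        homogeneous of degree two, and the \<open>c\<^sup>2\<close> terms cancel.\<close>
      moreover have "h i (U $ i) = w i * ((c\<^sup>2 + s\<^sup>2) * ?q i i)" "h j (U $ j) = w j * ((c\<^sup>2 + s\<^sup>2) * ?q j j)"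
        by (simp_all add: h_def cs)
      ultimately show "c * s * (2 * (w i - w j) * ?q i j) \<le> s\<^sup>2 * ((w i - w j) * (?q i i - ?q j j))"
        by (simp add: algebra_simps)
    qed
    moreover have "w i \<noteq> w j" using that w0 by (simp add: w_def inj_eq)
    ultimately show ?thesis by simp
  qed
  define a where "a i = U $ i \<bullet> (A *v U $ i)" for i
  have entry: "(U ** A ** transpose U) $ i $ j = U $ i \<bullet> (A *v U $ j)" for i j
  proof -
    have "(U ** A ** transpose U) $ i $ j = (U ** (A ** transpose U)) $ i $ j"
      by (simp add: matrix_mul_assoc)
    then show ?thesis
      by (simp add: matrix_matrix_mult_def inner_vec_def matrix_vector_mult_def transpose_def)
  qed
  have diag: "U ** A ** transpose U = diag_mat a"
    by (auto simp: vec_eq_iff entry off a_def)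
  have "transpose U ** (U ** A ** transpose U) ** U = (transpose U ** U) ** A ** (transpose U ** U)"
    by (simp add: matrix_mul_assoc)
  then have "transpose U ** diag_mat a ** U = (transpose U ** U) ** A ** (transpose U ** U)"
    unfolding diag .
  then show ?thesis
    using U that[of U a] by (simp add: orthogonal_matrix)
qed

lemma psd_diagonalisable:
  fixes A :: "real^'k^'k"
  assumes "psd A"
  obtains U a where "orthogonal_matrix U" "A = transpose U ** diag_mat a ** U" "\<And>i. 0 \<le> a i"
proof -
  obtain U a where U: "orthogonal_matrix U" and A: "A = transpose U ** diag_mat a ** U"
    using assms symmetric_mat_diagonalisable[of A] unfolding psd_def by blast
  have "0 \<le> a i" for i
  proof -
    have UU: "U ** transpose U = mat 1"
      using U by (simp add: orthogonal_matrix_def)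
    \<comment> \<open>The \<open>i\<close>th row of \<open>U\<close>, an eigenvector of
      \<open>A\<close> for \<open>a i\<close>; the quadratic form at \<open>x\<close> returns
      \<open>a i\<close>.\<close>
    define x where "x = transpose U *v axis i 1"
    have "U *v x = axis i 1"
      unfolding x_def by (simp only: matrix_vector_mul_assoc UU matrix_vector_mul_lid)
    moreover have "x \<bullet> (A *v x) = (U *v x) \<bullet> (diag_mat a *v (U *v x))"
    proof -
      have Ax: "A *v x = (diag_mat a *v (U *v x)) v* U"
        unfolding A transpose_matrix_vector[symmetric] by (simp only: matrix_vector_mul_assoc matrix_mul_assoc)
      have "x \<bullet> (A *v x) = ((diag_mat a *v (U *v x)) v* U) \<bullet> x"
        unfolding Ax by (rule inner_commute)
      also have "\<dots> = (U *v x) \<bullet> (diag_mat a *v (U *v x))"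
        unfolding dot_lmul_matrix by (rule inner_commute)
      finally show ?thesis .
    qed
    moreover have "axis i 1 \<bullet> (diag_mat a *v axis i 1) = a i"
      by (simp only: inner_axis' matrix_vector_mult_basis column_def) simp
    moreover have "0 \<le> x \<bullet> (A *v x)"
      using assms by (simp add: psd_def)
    ultimately show ?thesis by simp
  qed
  then show ?thesis using U A that by blast
qed

text \<open>
  \<open>Q\<close> is the transpose of a maximiser of \<open>trace (U ** M)\<close>: rotations of the rows give symmetry,
  reflections give semidefiniteness.
\<close>

lemma polar_decomposition:
  fixes M :: "real^'k^'k"
  obtains Q where "orthogonal_matrix Q" "psd (transpose Q ** M)"
proof -
  define h where "h l x = x \<bullet> column l M" for l and x :: "real^'k"
  have "continuous_on UNIV (\<lambda>U :: real^'k^'k. \<Sum>l\<in>UNIV. h l (U $ l))"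
    unfolding h_def by (intro continuous_intros)
  then obtain U where U: "orthogonal_matrix U"
    and max: "\<And>V. orthogonal_matrix V \<Longrightarrow> (\<Sum>l\<in>UNIV. h l (V $ l)) \<le> (\<Sum>l\<in>UNIV. h l (U $ l))"
    by (rule orthogonal_matrix_attains_sup) blast
  have entry: "(U ** M) $ i $ j = h j (U $ i)" for i j
    by (simp add: matrix_matrix_mult_def h_def inner_vec_def column_def)
  have "h i (U $ j) - h j (U $ i) = 0" if "i \<noteq> j" for i j
  proof (rule first_order_optimality_rotation)
    fix c s :: real
    assume cs: "c\<^sup>2 + s\<^sup>2 = 1"
    have rot: "c * (h i (U $ i) + h j (U $ j)) + s * (h i (U $ j) - h j (U $ i)) \<le> h i (U $ i) + h j (U $ j)"
      if "c\<^sup>2 + s\<^sup>2 = 1" for c s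
      using max[OF orthogonal_matrix_rotate_rows[OF U \<open>i \<noteq> j\<close> that]]
        sum_rotate_rows[OF \<open>i \<noteq> j\<close>, of h c s U]
      by (simp add: h_def inner_simps algebra_simps)
    \<comment> \<open>The increment is linear in \<open>c\<close> and \<open>s\<close>; evaluating
      it at the double angle gives the quadratic form that the optimality lemma expects.\<close>
    have "(c\<^sup>2 - s\<^sup>2) * (h i (U $ i) + h j (U $ j)) + 2 * c * s * (h i (U $ j) - h j (U $ i))
        \<le> (c\<^sup>2 + s\<^sup>2) * (h i (U $ i) + h j (U $ j))"
    proof -
      have "(c\<^sup>2 - s\<^sup>2)\<^sup>2 + (2 * c * s)\<^sup>2 = (c\<^sup>2 + s\<^sup>2)\<^sup>2" by algebra
      then show ?thesis using rot[of "c\<^sup>2 - s\<^sup>2" "2 * c * s"] cs by simp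
    qed
    then show "c * s * (h i (U $ j) - h j (U $ i)) \<le> s\<^sup>2 * (h i (U $ i) + h j (U $ j))"
      by (simp add: algebra_simps)
  qed
  then have "symmetric_mat (U ** M)"
    by (simp add: symmetric_mat_def vec_eq_iff transpose_def entry) (metis)
  moreover have "0 \<le> x \<bullet> (U ** M *v x)" for x
  proof (cases "x = 0")
    case False
    define y where "y = x v* U"
    \<comment> \<open>With this \<open>k\<close>, the matrix \<open>V\<close> below is a Householder
      reflection along \<open>x\<close> applied to \<open>U\<close>; orthogonality rests on
      \<open>2 - k * (x \<bullet> x) = 0\<close>.\<close>
    define k where "k = 2 / (x \<bullet> x)"
    have k: "k * (x \<bullet> x) = 2" "0 < k" using False by (simp_all add: k_def)
    define V where "V = (\<chi> l. U $ l - (k * x $ l) *\<^sub>R y)"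
    have y_sum: "y = (\<Sum>r\<in>UNIV. x $ r *\<^sub>R U $ r)"
      by (simp add: y_def vec_eq_iff vector_matrix_mult_def mult.commute)
    have Uy: "U $ l \<bullet> y = x $ l" for l
      using U by (simp add: y_sum inner_sum_right orthogonal_matrix_inner_rows
          if_distrib[of "\<lambda>z. _ * z"] cong: if_cong)
    then have yU: "y \<bullet> U $ l = x $ l" for l by (simp add: inner_commute)
    have "y \<bullet> y = (\<Sum>r\<in>UNIV. x $ r * (U $ r \<bullet> y))"
      by (subst (1) y_sum) (simp add: inner_sum_left)
    then have yy: "y \<bullet> y = x \<bullet> x" by (simp add: Uy) (simp add: inner_vec_def)
    have "V $ i \<bullet> V $ j = U $ i \<bullet> U $ j - k * x $ i * x $ j * (2 - k * (x \<bullet> x))" for i j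
      unfolding V_def by (simp add: inner_diff_left inner_diff_right Uy yU yy algebra_simps)
    then have "orthogonal_matrix V" using U by (simp add: orthogonal_matrix_inner_rows k)
    from max[OF this] have "0 \<le> (\<Sum>l\<in>UNIV. k * x $ l * h l y)"
      by (simp add: V_def h_def inner_diff_left sum_subtractf)
    also have "\<dots> = k * (\<Sum>l\<in>UNIV. x $ l * h l y)"
      by (simp add: sum_distrib_left mult.assoc)
    also have "(\<Sum>l\<in>UNIV. x $ l * h l y) = y \<bullet> (M *v x)"
      by (simp add: h_def matrix_mult_sum inner_sum_right scalar_mult_eq_scaleR)
    also have "\<dots> = x \<bullet> (U ** M *v x)"
      by (simp add: y_def dot_lmul_matrix matrix_vector_mul_assoc)
    finally show ?thesis using k by (simp add: zero_le_mult_iff)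
  qed simp
  ultimately show ?thesis
    using that[of "transpose U"] U by (simp add: psd_def)
qed

section \<open>A trace inequality\<close>

text \<open>In the induction step, \<open>c\<close> times the hypothesis is added to a product of
  two factors of equal sign.\<close>

lemma young_power:
  fixes b c :: real
  assumes "0 \<le> b" "0 \<le> c"
  shows "real (Suc p) * (b * c ^ p) \<le> b ^ Suc p + p * c ^ Suc p"
proof (induction p)
  case (Suc p)
  have "0 \<le> (b - c) * (b ^ Suc p - c ^ Suc p)"
    using assms power_mono[of b c "Suc p"] power_mono[of c b "Suc p"]
    by (cases "b \<le> c") (auto intro: mult_nonpos_nonpos mult_nonneg_nonneg simp del: power_Suc)
  with mult_left_mono[OF Suc \<open>0 \<le> c\<close>] show ?case
    by (simp add: algebra_simps)
qed simp

text \<open>\<open>F\<close> is an isometry, so Cauchy-Schwarz for \<open>x\<close> and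
  \<open>F *v (transpose F *v x)\<close> makes its transpose a contraction.\<close>

lemma norm_transpose_mult_vector_le:
  fixes F :: "real^'k^'n"
  assumes "F \<in> St"
  shows "norm (transpose F *v x) \<le> norm x"
proof -
  let ?z = "transpose F *v x"
  have "norm (F *v z) = norm z" for z
  proof -
    have "(F *v z) \<bullet> (F *v z) = (transpose F ** F *v z) \<bullet> z"
      by (metis dot_lmul_matrix inner_commute matrix_vector_mul_assoc transpose_matrix_vector)
    then show ?thesis using assms by (simp add: St_def norm_eq_sqrt_inner)
  qed
  then have "norm ?z * norm ?z \<le> norm x * norm ?z"
    using norm_cauchy_schwarz[of x "F *v ?z"]
    by (metis dot_lmul_matrix norm_eq_sqrt_inner power2_eq_square power2_norm_eq_inner transpose_matrix_vector)
  then show ?thesis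
    by (cases "norm ?z = 0") (auto simp: mult_le_cancel_right)
qed

text \<open>This row is \<open>transpose F\<close> applied to a unit column of \<open>E\<close>.
  Exchanging \<open>E\<close> and \<open>F\<close> bounds the columns.\<close>

lemma norm_row_transpose_mult_le_1:
  fixes E F :: "real^'k^'n"
  assumes "E \<in> St" "F \<in> St"
  shows "norm ((transpose E ** F) $ i) \<le> 1"
proof -
  have "(transpose E ** F) $ i = transpose F *v column i E"
    by (simp add: vec_eq_iff matrix_matrix_mult_def matrix_vector_mult_def transpose_def column_def mult.commute)
  moreover have "norm (column i E) = 1"
    using assms(1) by (simp add: St_def vec_eq_iff matrix_mult_transpose_dot_column mat_def norm_eq_1)
  ultimately show ?thesis
    using norm_transpose_mult_vector_le[OF assms(2), of "column i E"] by simp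
qed

lemma sum_abs_mult_le_1:
  fixes x y :: "real^'k"
  assumes "norm x \<le> 1" "norm y \<le> 1"
  shows "(\<Sum>i\<in>UNIV. \<bar>x $ i\<bar> * \<bar>y $ i\<bar>) \<le> 1"
proof -
  have "(\<Sum>i\<in>UNIV. \<bar>x $ i\<bar> * \<bar>y $ i\<bar>) \<le> L2_set (($) x) UNIV * L2_set (($) y) UNIV"
    by (rule L2_set_mult_ineq)
  also have "\<dots> = norm x * norm y" by (simp add: norm_vec_def L2_set_def)
  also have "\<dots> \<le> 1" using assms by (simp add: mult_le_one)
  finally show ?thesis .
qed

text \<open>
  In eigenbases of \<open>A\<close> and \<open>B\<close> the left trace is a sum of \<open>b i * a j ^ p\<close> with weights
  \<open>X i j * Y j i\<close>. Their moduli form a doubly substochastic matrix because the rows and columns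
  of the orthogonal matrix \<open>X\<close> and of the contraction \<open>Y\<close> have norm at most 1.
\<close>

lemma trace_psd_mult_matpow_le:
  fixes A B :: "real^'k^'k" and P R :: "real^'k^'n"
  assumes "psd A" "psd B" "P \<in> St" "R \<in> St"
  shows "Suc p * trace (B ** matpow A p ** (transpose P ** R))
    \<le> trace (matpow B (Suc p)) + p * trace (matpow A (Suc p))"
proof -
  obtain U a where U: "orthogonal_matrix U" and A: "A = transpose U ** diag_mat a ** U" and a: "\<And>i. 0 \<le> a i"
    using psd_diagonalisable[OF \<open>psd A\<close>] by blast
  obtain V b where V: "orthogonal_matrix V" and B: "B = transpose V ** diag_mat b ** V" and b: "\<And>i. 0 \<le> b i"
    using psd_diagonalisable[OF \<open>psd B\<close>] by blast
  have orth: "U ** transpose U = mat 1" "V ** transpose V = mat 1"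
    using U V by (simp_all add: orthogonal_matrix_def)
  have pow: "trace (matpow (transpose W ** diag_mat c ** W) m) = (\<Sum>i\<in>UNIV. c i ^ m)"
    if "W ** transpose W = mat 1" for W :: "real^'k^'k" and c m
  proof -
    have "trace (matpow (transpose W ** diag_mat c ** W) m) = trace (transpose W ** (diag_mat (\<lambda>i. c i ^ m) ** W))"
      by (simp add: matpow_conj[OF that] matpow_diag_mat matrix_mul_assoc)
    also have "\<dots> = trace (diag_mat (\<lambda>i. c i ^ m) ** (W ** transpose W))"
      by (subst trace_mul_sym) (simp add: matrix_mul_assoc)
    finally show ?thesis by (simp add: that trace_def)
  qed
  \<comment> \<open>\<open>X\<close> changes between the eigenbases of \<open>A\<close> and
    \<open>B\<close>; \<open>Y\<close> is \<open>transpose P ** R\<close> written in them.\<close>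
  define X where "X = V ** transpose U"
  define E where "E = P ** transpose U"
  define F where "F = R ** transpose V"
  define Y where "Y = transpose E ** F"
  have St: "E \<in> St" "F \<in> St"
  proof -
    have "W ** transpose (Z :: real^'k^'n) ** Z ** transpose W = mat 1"
      if "Z \<in> St" "W ** transpose W = mat 1" for W Z
      using that by (simp add: St_def flip: matrix_mul_assoc)
    with assms orth show "E \<in> St" "F \<in> St"
      by (simp_all add: E_def F_def St_def matrix_transpose_mul matrix_mul_assoc)
  qed
  have Y_row: "norm (Y $ j) \<le> 1" for j
    unfolding Y_def using St by (rule norm_row_transpose_mult_le_1)
  have Y_col: "norm (\<chi> j. Y $ j $ i) \<le> 1" for i
  proof -
    have "(\<chi> j. Y $ j $ i) = (transpose F ** E) $ i"
      by (simp add: Y_def vec_eq_iff matrix_matrix_mult_def transpose_def mult.commute)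
    then show ?thesis using St norm_row_transpose_mult_le_1 by metis
  qed
  have "orthogonal_matrix X" 
    using U V by (simp add: X_def orthogonal_matrix_mul)
  then have X_row: "norm (X $ i) \<le> 1" and X_col: "norm (transpose X $ j) \<le> 1" for i j
    by (metis (no_types) norm_eq_1 order_refl orthogonal_matrix_inner_rows orthogonal_matrix_transpose)+
  define w where "w i j = \<bar>X $ i $ j\<bar> * \<bar>Y $ j $ i\<bar>" for i j
  have w: "0 \<le> w i j" "(\<Sum>j\<in>UNIV. w i j) \<le> 1" "(\<Sum>i\<in>UNIV. w i j) \<le> 1" for i j
    using sum_abs_mult_le_1[OF X_row Y_col, of i i] sum_abs_mult_le_1[OF X_col Y_row, of j j]
    by (simp_all add: w_def transpose_def)
  have "trace (B ** matpow A p ** (transpose P ** R))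
      = trace (transpose V ** (diag_mat b ** X ** diag_mat (\<lambda>i. a i ^ p) ** (U ** transpose P ** R)))"
    by (simp add: A B X_def matpow_conj[OF orth(1)] matpow_diag_mat matrix_mul_assoc)
  also have "\<dots> = trace ((diag_mat b ** X) ** (diag_mat (\<lambda>i. a i ^ p) ** Y))"
    by (subst trace_mul_sym) (simp add: Y_def E_def F_def matrix_transpose_mul matrix_mul_assoc)
  also have "\<dots> = (\<Sum>i\<in>UNIV. \<Sum>j\<in>UNIV. b i * X $ i $ j * (a j ^ p * Y $ j $ i))"
    by (simp add: diag_mat_mult trace_def) (simp add: matrix_matrix_mult_def)
  \<comment> \<open>Since \<open>b i\<close> and \<open>a j ^ p\<close> are nonnegative, passing to
    moduli of the weights can only enlarge the sum.\<close>
  also have "\<dots> \<le> (\<Sum>i\<in>UNIV. \<Sum>j\<in>UNIV. (b i * a j ^ p) * w i j)"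
  proof (intro sum_mono)
    fix i j
    have "b i * X $ i $ j * (a j ^ p * Y $ j $ i) \<le> \<bar>b i * X $ i $ j * (a j ^ p * Y $ j $ i)\<bar>"
      by (rule abs_ge_self)
    also have "\<dots> = (b i * a j ^ p) * w i j"
      using a b by (simp add: w_def abs_mult)
    finally show "b i * X $ i $ j * (a j ^ p * Y $ j $ i) \<le> (b i * a j ^ p) * w i j" .
  qed
  finally have "Suc p * trace (B ** matpow A p ** (transpose P ** R))
      \<le> Suc p * (\<Sum>i\<in>UNIV. \<Sum>j\<in>UNIV. (b i * a j ^ p) * w i j)"
    by (rule mult_left_mono) simp
  also have "\<dots> = (\<Sum>i\<in>UNIV. \<Sum>j\<in>UNIV. Suc p * (b i * a j ^ p) * w i j)"
    by (simp add: sum_distrib_left mult.assoc)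
  also have "\<dots> \<le> (\<Sum>i\<in>UNIV. \<Sum>j\<in>UNIV. (b i ^ Suc p + p * a j ^ Suc p) * w i j)"
    by (intro sum_mono mult_right_mono young_power a b w)
  \<comment> \<open>Row sums of \<open>w\<close> collect at \<open>b\<close>, column sums at
    \<open>a\<close>; both are at most 1.\<close>
  also have "\<dots> = (\<Sum>i\<in>UNIV. b i ^ Suc p * (\<Sum>j\<in>UNIV. w i j)) + p * (\<Sum>j\<in>UNIV. a j ^ Suc p * (\<Sum>i\<in>UNIV. w i j))"
  proof -
    have "(\<Sum>i\<in>UNIV. \<Sum>j\<in>UNIV. p * a j ^ Suc p * w i j) = (\<Sum>j\<in>UNIV. \<Sum>i\<in>UNIV. p * a j ^ Suc p * w i j)"
      by (rule sum.swap)
    then show ?thesis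
      by (simp add: distrib_right sum.distrib sum_distrib_left mult.assoc del: power_Suc)
  qed
  also have "\<dots> \<le> (\<Sum>i\<in>UNIV. b i ^ Suc p) + p * (\<Sum>j\<in>UNIV. a j ^ Suc p)"
    by (intro add_mono mult_left_mono sum_mono mult_left_le w) (simp_all add: a b)
  also have "\<dots> = trace (matpow B (Suc p)) + p * trace (matpow A (Suc p))"
    unfolding A B by (simp only: pow orth)
  finally show ?thesis .
qed

section \<open>The atomic function\<close>

lemma partials_f_pow:
  fixes D P :: "real^'k^'n"
  shows "partials (f_pow D m) P = real m *\<^sub>R (D ** matpow (transpose P ** D) (m - 1))"
proof -
  have "partials (f_pow D m) P $ i $ j = (real m *\<^sub>R (D ** matpow (transpose P ** D) (m - 1))) $ i $ j"
    for i j
  proof -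
    \<comment> \<open>Varying one entry makes \<open>X\<close> affine in \<open>t\<close> with slope
      \<open>E\<close>, which carries row \<open>i\<close> of \<open>D\<close> in its row
      \<open>j\<close>.\<close>
    define X where "X t = transpose (\<chi> a b. if a = i \<and> b = j then t else P $ a $ b) ** D" for t
    define E where "E = (\<chi> b c. if b = j then D $ i $ c else 0)"
    have X_eq: "X t = transpose P ** D + (t - P $ i $ j) *\<^sub>R E" for t
    proof -
      have "(if a = i \<and> b = j then t else P $ a $ b) * D $ a $ c
          = P $ a $ b * D $ a $ c + (if a = i then (t - P $ i $ j) * (if b = j then D $ i $ c else 0) else 0)"
        for a b c by (simp add: algebra_simps)
      then show ?thesis
        by (simp add: X_def E_def vec_eq_iff matrix_matrix_mult_def transpose_def sum.distrib)
    qed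
    have "(X has_vector_derivative E) (at (P $ i $ j))"
      unfolding X_eq by (auto intro!: derivative_eq_intros)
    from trace_matpow_has_field_derivative[OF this, of m]
    have "deriv (\<lambda>t. trace (matpow (X t) m)) (P $ i $ j)
        = m * trace (matpow (transpose P ** D) (m - 1) ** E)"
      by (simp add: DERIV_imp_deriv X_eq)
    \<comment> \<open>Cyclicity puts \<open>E\<close> first; only its row \<open>j\<close>
      contributes, so the trace is a single matrix entry.\<close>
    also have "trace (matpow (transpose P ** D) (m - 1) ** E)
        = (D ** matpow (transpose P ** D) (m - 1)) $ i $ j"
      unfolding trace_mul_sym[of _ E]
      by (simp add: trace_def E_def matrix_matrix_mult_def if_distrib[of "\<lambda>x. x * _"] 
        sum.swap[of _ UNIV UNIV] cong: if_cong)
    finally show ?thesis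
      by (simp add: partials_def f_pow_def X_def)
  qed
  then show ?thesis by (simp add: vec_eq_iff)
qed

lemma symmetric_mat_H_pow: "symmetric_mat (H_pow D m P)"
  by (simp add: symmetric_mat_def H_pow_def transpose_scalar transpose_add matrix_transpose_mul
      transpose_matpow matrix_mul_assoc add.commute)

text \<open>In the first summand of \<open>H_pow\<close> the factor \<open>transpose P ** P\<close>
  cancels, leaving the gradient; the second absorbs \<open>transpose D ** P\<close> into its
  power.\<close>

lemma H_pow_mult_eq:
  fixes D P :: "real^'k^'n"
  assumes "P \<in> St" "m \<ge> 1"
  shows "H_pow D m P ** P = partials (f_pow D m) P + P ** (real m *\<^sub>R matpow (transpose D ** P) m)"
proof -
  obtain p where m: "m = Suc p" using \<open>m \<ge> 1\<close> by (cases m) auto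
  have PP: "X ** transpose P ** P = X" for X :: "real^'k^'a"
    using assms by (simp add: St_def flip: matrix_mul_assoc)
  have "P ** matpow (transpose D ** P) p ** transpose D ** P = P ** matpow (transpose D ** P) m"
    unfolding m matpow_Suc_right by (simp add: matrix_mul_assoc)
  then show ?thesis
    by (simp add: H_pow_def partials_f_pow matrix_mult_scaleR matrix_add_rdistrib scaleR_add_right PP m del: matpow.simps)
qed

text \<open>The two summands of \<open>H_pow\<close> contribute a matrix and its transpose, hence
  equal traces. Both the identity (\<open>R = P\<close>) and the inequality start from this
  form.\<close>

lemma trace_H_pow:
  fixes D P R :: "real^'k^'n"
  shows "trace (transpose R ** H_pow D m P ** R)
    = 2 * m * trace ((transpose R ** D) ** matpow (transpose P ** D) (m - 1) ** (transpose P ** R))"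
proof -
  let ?T = "(transpose R ** D) ** matpow (transpose P ** D) (m - 1) ** (transpose P ** R)"
  have "transpose R ** H_pow D m P ** R = real m *\<^sub>R (?T + transpose ?T)"
    by (simp add: H_pow_def matrix_mult_scaleR matrix_add_rdistrib matrix_add_ldistrib
        matrix_transpose_mul transpose_matpow matrix_mul_assoc)
  then show ?thesis by (simp only: trace_scaleR trace_add trace_transpose) simp
qed

lemma trace_H_pow_self:
  fixes D P :: "real^'k^'n"
  assumes "P \<in> St" "m \<ge> 1"
  shows "trace (transpose P ** H_pow D m P ** P) = 2 * m * f_pow D m P"
  using assms by (cases m) (simp_all add: trace_H_pow f_pow_def St_def)

lemma trace_H_pow_le:
  fixes D P R :: "real^'k^'n"
  assumes "P \<in> St_Dplus D" "R \<in> St_Dplus D" "m \<ge> 1"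
  shows "trace (transpose R ** H_pow D m P ** R) \<le> 2 * f_pow D m R + 2 * (real m - 1) * f_pow D m P"
proof -
  obtain p where m: "m = Suc p" using \<open>m \<ge> 1\<close> by (cases m) auto
  show ?thesis
    using trace_psd_mult_matpow_le[of "transpose P ** D" "transpose R ** D" P R p] assms
    by (simp add: m trace_H_pow f_pow_def St_Dplus_def algebra_simps)
qed

lemma atomic_NEPv_with_f_pow:
  fixes D :: "real^'k^'n"
  assumes "m \<ge> 1"
  shows "atomic_NEPv_with (f_pow D m) (H_pow D m) (St_Dplus D) 2 (2 * (real m - 1))"
proof -
  have "\<exists>Q\<in>St. Ph ** Q \<in> St_Dplus D \<and>
      trace (transpose Ph ** H_pow D m P ** Ph) \<le> 2 * f_pow D m (Ph ** Q) + 2 * (real m - 1) * f_pow D m P"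
    if P: "P \<in> St_Dplus D" and Ph: "Ph \<in> St" for P Ph :: "real^'k^'n"
  proof -
    \<comment> \<open>The polar factor of \<open>transpose Ph ** D\<close> makes
      \<open>transpose (Ph ** Q) ** D\<close> semidefinite.\<close>
    obtain Q where Q: "orthogonal_matrix Q" and psd: "psd (transpose Q ** (transpose Ph ** D))"
      using polar_decomposition by blast
    have QQ: "transpose Q ** Q = mat 1" "Q ** transpose Q = mat 1"
      using Q by (simp_all add: orthogonal_matrix_def)
    have "transpose Q ** (transpose Ph ** Ph) ** Q = mat 1"
      using Ph QQ by (simp add: St_def)
    with psd have mem: "Ph ** Q \<in> St_Dplus D"
      by (simp add: St_Dplus_def St_def matrix_transpose_mul matrix_mul_assoc)
    \<comment> \<open>Right multiplication by the orthogonal \<open>Q\<close> preserves this trace,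
      so the inequality for \<open>Ph ** Q\<close> transfers to \<open>Ph\<close>.\<close>
    have "trace (transpose (Ph ** Q) ** H_pow D m P ** (Ph ** Q))
        = trace (transpose Q ** (transpose Ph ** H_pow D m P ** Ph ** Q))"
      by (simp add: matrix_transpose_mul matrix_mul_assoc)
    also have "\<dots> = trace (transpose Ph ** H_pow D m P ** Ph ** (Q ** transpose Q))"
      by (subst trace_mul_sym) (simp add: matrix_mul_assoc)
    finally have "trace (transpose (Ph ** Q) ** H_pow D m P ** (Ph ** Q))
        = trace (transpose Ph ** H_pow D m P ** Ph)"
      by (simp add: QQ)
    with trace_H_pow_le[OF P mem assms] mem QQ show ?thesis
      by (auto simp: St_def)
  qed
  moreover have "St_Dplus D \<subseteq> St" by (auto simp: St_Dplus_def)
  ultimately show ?thesis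
    using assms trace_H_pow_self[of _ m D]
    by (auto simp: atomic_NEPv_with_def atomic_cond1_def atomic_cond2_def symmetric_mat_H_pow)
qed

text \<open>\<open>H_pow D m P ** P\<close> and the gradient differ by \<open>P\<close> times a
  square matrix, so \<open>\<Omega>\<close> exists exactly when a possibly nonsymmetric multiplier
  does.\<close>

lemma KKT_f_pow_iff:
  fixes D P :: "real^'k^'n"
  assumes "P \<in> St" "m \<ge> 1"
  shows "(\<exists>\<Omega>::real^'k^'k. H_pow D m P ** P = P ** \<Omega>) \<and> symmetric_mat (matpow (transpose P ** D) m)
    \<longleftrightarrow> KKT (f_pow D m) P"
proof -
  let ?A = "matpow (transpose P ** D) m"
  let ?L = "real m *\<^sub>R matpow (transpose D ** P) m"
  have \<Lambda>: "\<Lambda> = real m *\<^sub>R ?A" if "partials (f_pow D m) P = P ** \<Lambda>" for \<Lambda>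
  proof -
    have "\<Lambda> = transpose P ** (P ** \<Lambda>)"
      using \<open>P \<in> St\<close> by (simp add: St_def matrix_mul_assoc)
    also have "\<dots> = transpose P ** partials (f_pow D m) P" by (simp add: that)
    also have "\<dots> = real m *\<^sub>R ?A"
      using \<open>m \<ge> 1\<close> by (cases m) (simp_all add: partials_f_pow matrix_mult_scaleR matrix_mul_assoc)
    finally show ?thesis .
  qed
  have sym: "symmetric_mat (real m *\<^sub>R ?A) \<longleftrightarrow> symmetric_mat ?A"
    using \<open>m \<ge> 1\<close> by (simp add: symmetric_mat_def transpose_scalar)
  have HP: "H_pow D m P ** P = partials (f_pow D m) P + P ** ?L"
    using assms by (rule H_pow_mult_eq)
  have "(\<exists>\<Omega>. H_pow D m P ** P = P ** \<Omega>) \<longleftrightarrow> (\<exists>\<Lambda>. partials (f_pow D m) P = P ** \<Lambda>)"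
  proof
    assume "\<exists>\<Omega>. H_pow D m P ** P = P ** \<Omega>"
    then obtain \<Omega> where "H_pow D m P ** P = P ** \<Omega>" by blast
    with HP have "partials (f_pow D m) P = P ** (\<Omega> - ?L)"
      by (simp add: bounded_bilinear.diff_right[OF bounded_bilinear_matrix_mult] eq_diff_eq)
    then show "\<exists>\<Lambda>. partials (f_pow D m) P = P ** \<Lambda>" by blast
  next
    assume "\<exists>\<Lambda>. partials (f_pow D m) P = P ** \<Lambda>"
    then show "\<exists>\<Omega>. H_pow D m P ** P = P ** \<Omega>"
      using HP by (metis matrix_add_ldistrib)
  qed
  then show ?thesis
    using \<Lambda> sym \<open>P \<in> St\<close> unfolding KKT_def by metis
qed

theorem theorem7p4:
  fixes D :: "real^'k::finite^'n::finite" and m :: nat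
  assumes "CARD('k) \<le> CARD('n)" and "m \<ge> 1"
  shows
    "(\<forall>P\<in>St. symmetric_mat (H_pow D m P)) \<and>
     (\<forall>P\<in>St. H_pow D m P ** P - partials (f_pow D m) P
              = P ** (real m *\<^sub>R matpow (transpose D ** P) m)) \<and>
     (\<forall>P\<in>St. trace (transpose P ** H_pow D m P ** P)
              = 2 * real m * trace (matpow (transpose P ** D) m)) \<and>
     (\<forall>P\<in>St_Dplus D. \<forall>Pt\<in>St_Dplus D.
        trace (transpose Pt ** H_pow D m P ** Pt)
        \<le> 2 * trace (matpow (transpose Pt ** D) m)
          + 2 * (real m - 1) * trace (matpow (transpose P ** D) m)) \<and>
     atomic_NEPv_with (f_pow D m) (H_pow D m) (St_Dplus D) 2 (2 * (real m - 1)) \<and>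
     (\<forall>\<delta>>0. atomic_NEPv (St_nbhd \<delta>) (f_pow D m)) \<and>
     (\<forall>P\<in>St.
        (\<exists>\<Omega>::real^'k^'k. H_pow D m P ** P = P ** \<Omega>) \<and>
        symmetric_mat (matpow (transpose P ** D) m)
        \<longleftrightarrow> KKT (f_pow D m) P)"
proof (intro conjI ballI allI impI)
  show "atomic_NEPv_with (f_pow D m) (H_pow D m) (St_Dplus D) 2 (2 * (real m - 1))"
    using \<open>m \<ge> 1\<close> by (rule atomic_NEPv_with_f_pow)
  then show "atomic_NEPv (St_nbhd \<delta>) (f_pow D m)" if "\<delta> > 0" for \<delta>
    using that unfolding atomic_NEPv_def by blast
  fix P :: "real^'k^'n"
  assume P: "P \<in> St"
  show "symmetric_mat (H_pow D m P)"
    by (rule symmetric_mat_H_pow)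
  show "H_pow D m P ** P - partials (f_pow D m) P = P ** (real m *\<^sub>R matpow (transpose D ** P) m)"
    using H_pow_mult_eq[OF P \<open>m \<ge> 1\<close>] by simp
  show "trace (transpose P ** H_pow D m P ** P) = 2 * real m * trace (matpow (transpose P ** D) m)"
    using trace_H_pow_self[OF P \<open>m \<ge> 1\<close>] by (simp add: f_pow_def)
  show "((\<exists>\<Omega>::real^'k^'k. H_pow D m P ** P = P ** \<Omega>) \<and> symmetric_mat (matpow (transpose P ** D) m))
      \<longleftrightarrow> KKT (f_pow D m) P"
    using P \<open>m \<ge> 1\<close> by (rule KKT_f_pow_iff)
next
  fix P Pt
  assume "P \<in> St_Dplus D" "Pt \<in> St_Dplus D"
  from trace_H_pow_le[OF this \<open>m \<ge> 1\<close>]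
  show "trace (transpose Pt ** H_pow D m P ** Pt)
      \<le> 2 * trace (matpow (transpose Pt ** D) m) + 2 * (real m - 1) * trace (matpow (transpose P ** D) m)"
    by (simp add: f_pow_def)
qed

end
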